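(* Let $\mu>0$, $\eta>0$, $\rho>0$, $q>0$, let $\alpha<0<\beta$ be the roots of $\tfrac12\eta^2\theta^2+\mu\theta-\rho=0$, and let $b_\circ=\frac{1}{\alpha-\beta}\ln\big(\frac{\beta^2}{\alpha^2}\big)$. There exists a unique solution $b$ on $[0,\infty)$ of the Cauchy problem $$b'(i)=\mathcal B(b(i),i),\quad i>0,\qquad b(0)=b_\circ,$$ where $$\mathcal B(b,i)=\frac{q}{\alpha\beta}\left(\frac{\alpha^2e^{\beta(i-b)}-\beta^2e^{\alpha(i-b)}}{\beta e^{\alpha(i-b)}-\alpha e^{\beta(i-b)}}\right).$$ This solution is strictly decreasing on $(0,\infty)$ and satisfies $\lim_{i\downarrow0}b'(i)=0$ and $\lim_{i\uparrow\infty}b(i)=-\infty$.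
   Context: A solution is a real-valued function continuous on $[0,\infty)$ and differentiable on $(0,\infty)$; the ODE is considered on the domain $\{(b,i)\in\mathbb R^2:i>0\}$. Explicitly $\alpha=\frac{-\mu-\sqrt{\mu^2+2\rho\eta^2}}{\eta^2}$ and $\beta=\frac{-\mu+\sqrt{\mu^2+2\rho\eta^2}}{\eta^2}$. *)

theory Defs
  imports "HOL-Analysis.Analysis"
begin

definition rhs :: "real \<Rightarrow> real \<Rightarrow> real \<Rightarrow> real \<Rightarrow> real \<Rightarrow> real" where
  "rhs q \<alpha> \<beta> b i =
     q / (\<alpha> * \<beta>) *
       ((\<alpha>\<^sup>2 * exp (\<beta> * (i - b)) - \<beta>\<^sup>2 * exp (\<alpha> * (i - b))) /
        (\<beta> * exp (\<alpha> * (i - b)) - \<alpha> * exp (\<beta> * (i - b))))"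

definition b_circ :: "real \<Rightarrow> real \<Rightarrow> real" where
  "b_circ \<alpha> \<beta> = 1 / (\<alpha> - \<beta>) * ln (\<beta>\<^sup>2 / \<alpha>\<^sup>2)"

text \<open>A solution on \<open>[0,\<infinity>)\<close> is represented by a total function whose values on the negative
  reals are irrelevant, so solutions are to be compared on \<open>{0..}\<close> only.  At \<open>0\<close> only
  (one-sided) continuity is required.\<close>

definition cauchy_solution :: "real \<Rightarrow> real \<Rightarrow> real \<Rightarrow> (real \<Rightarrow> real) \<Rightarrow> bool" where
  "cauchy_solution q \<alpha> \<beta> b \<longleftrightarrow>
     continuous_on {0..} b \<and>
     (\<forall>i>0. (b has_real_derivative rhs q \<alpha> \<beta> (b i) i) (at i)) \<and>
     b 0 = b_circ \<alpha> \<beta>"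

end

theory Submission
  imports Defs
begin

text \<open>The right-hand side depends on \<open>i\<close> and \<open>b\<close> only through \<open>u = i - b\<close>, which turns the problem
  into the autonomous equation \<open>u' = 1 - F u\<close>.  The function \<open>F\<close> is Lipschitz, strictly decreasing,
  bounded below, and \<open>b_circ\<close> is chosen so that \<open>F\<close> vanishes at the starting value of \<open>u\<close>.
  Separation of variables therefore gives a global solution (the travel time \<open>\<integral> 1 / (1 - F)\<close> is
  unbounded), a Gronwall argument gives uniqueness, and the qualitative statements are read off
  from the sign of \<open>b' = F u\<close>.\<close>

section \<open>Autonomous scalar equations: existence and uniqueness\<close>

text \<open>The solution is the inverse of the travel time \<open>T\<close>. The bound
  \<open>M\<close> on the speed keeps the slope of \<open>T\<close> at least \<open>1 / M\<close>,
  so \<open>T\<close> reaches every time and the solution cannot blow up. As \<open>G\<close> is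
  positive, the motion is upwards and stays in \<open>{u0..}\<close>.\<close>

lemma autonomous_ode_exists:
  fixes G :: "real \<Rightarrow> real"
  assumes cont: "continuous_on {u0..} G"
    and pos: "\<And>u. u \<ge> u0 \<Longrightarrow> 0 < G u"
    and bound: "\<And>u. u \<ge> u0 \<Longrightarrow> G u \<le> M"
  obtains U where "continuous_on {0..} U" and "U 0 = u0" and "\<And>t. t > 0 \<Longrightarrow> u0 < U t"
    and "\<And>t. t > 0 \<Longrightarrow> (U has_real_derivative G (U t)) (at t)"
proof -
  have M: "M > 0" using pos[of u0] bound[of u0] by simp
  define T where "T u = integral {u0..u} (\<lambda>v. 1 / G v)" for u
  have contf: "continuous_on {u0..x} (\<lambda>v. 1 / G v)" for x
    by (intro continuous_intros continuous_on_subset[OF cont]) (use pos in force)+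
  have T0: "T u0 = 0" by (simp add: T_def)
  have contT: "continuous_on {u0..x} T" for x
    unfolding T_def
    by (intro indefinite_integral_continuous_1 integrable_continuous_real contf)
  \<comment> \<open>To the left of \<open>u0\<close> the integral runs over an empty interval and
    \<open>T\<close> is 0, so a two-sided derivative is available only beyond
    \<open>u0\<close>.\<close>
  have derivT: "(T has_real_derivative 1 / G u) (at u)" if "u > u0" for u
  proof -
    have "(T has_real_derivative 1 / G u) (at u within {u0..u+1})"
      unfolding T_def by (rule integral_has_real_derivative[OF contf]) (use that in auto)
    moreover have "at u within {u0..u+1} = at u"
      by (rule at_within_interior) (use that in auto)
    ultimately show ?thesis by simp
  qed
  \<comment> \<open>The mean value theorem with \<open>1 / G \<ge> 1 / M\<close>. It serves three
    times: \<open>T\<close> reaches every \<open>t\<close>, \<open>U\<close> is Lipschitz, and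
    \<open>U 0 = u0\<close>.\<close>
  have expand: "y - x \<le> M * (T y - T x)" if "u0 \<le> x" "x \<le> y" for x y
  proof (cases "x = y")
    case False
    then have "x < y" using that by simp
    moreover have "continuous_on {x..y} T"
      by (rule continuous_on_subset[OF contT[of y]]) (use that in auto)
    moreover have "(T has_real_derivative 1 / G z) (at z)" if "x < z" for z
      using derivT that \<open>u0 \<le> x\<close> by simp
    ultimately obtain l z where z: "x < z" "z < y" "DERIV T z :> l" "T y - T x = (y - x) * l"
      using MVT[of x y T] real_differentiable_def by metis
    have "l = 1 / G z" using DERIV_unique[OF z(3) derivT[of z]] z that by simp
    moreover have "0 < G z" "G z \<le> M" using pos bound z that by auto
    ultimately have "1 \<le> M * l" by (simp add: le_divide_eq)
    then have "(y - x) * 1 \<le> (y - x) * (M * l)"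
      by (intro mult_left_mono) (use \<open>x < y\<close> in auto)
    then show ?thesis unfolding z(4) by (simp only: mult_1_right mult.left_commute)
  qed simp
  have "\<exists>u\<ge>u0. T u = t" if "t \<ge> 0" for t
  proof -
    have "u0 \<le> u0 + M * t" using M that by simp
    then have "T (u0 + M * t) \<ge> t" using expand[of u0 "u0 + M * t"] M by (simp add: T0)
    then show ?thesis
      using IVT'[of T u0 t "u0 + M * t"] contT T0 that M by auto
  qed
  then obtain U where U: "\<And>t. t \<ge> 0 \<Longrightarrow> u0 \<le> U t" "\<And>t. t \<ge> 0 \<Longrightarrow> T (U t) = t"
    by metis
  \<comment> \<open>\<open>U\<close> is a mere choice of preimages; its continuity comes from
    \<open>expand\<close> combined with \<open>T (U t) = t\<close>.\<close>
  have lip: "\<bar>U s - U t\<bar> \<le> M * \<bar>s - t\<bar>" if "s \<ge> 0" "t \<ge> 0" for s t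
  proof -
    have *: "U s - U t \<le> M * \<bar>s - t\<bar>" if "s \<ge> 0" "t \<ge> 0" for s t
    proof (cases "U t \<le> U s")
      case True
      then have "U s - U t \<le> M * (s - t)" using expand[of "U t" "U s"] U that by simp
      also have "\<dots> \<le> M * \<bar>s - t\<bar>" using M by simp
      finally show ?thesis .
    next
      case False
      then show ?thesis using M by (smt (verit) mult_nonneg_nonneg)
    qed
    show ?thesis using *[OF that] *[OF that(2,1)] by (simp add: abs_minus_commute abs_le_iff)
  qed
  have "M-lipschitz_on {0..} U"
    using lip M by (auto intro!: lipschitz_onI simp: dist_real_def)
  then have contU: "continuous_on {0..} U" by (rule lipschitz_on_continuous_on)
  have U0: "U 0 = u0" using expand[of u0 "U 0"] U[of 0] T0 by simp
  \<comment> \<open>The value \<open>u0\<close> would force \<open>t = T u0 = 0\<close>. Hence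
    \<open>T\<close> is differentiable at \<open>U t\<close>, and the inverse function rule applies
    there.\<close>
  have Upos: "u0 < U t" if "t > 0" for t
    using U[of t] that T0 by (cases "U t = u0") auto
  have "(U has_real_derivative G (U t)) (at t)" if "t > 0" for t
  proof -
    have "isCont U t"
      using contU that by (auto intro: continuous_on_interior)
    then have "(U has_real_derivative inverse (1 / G (U t))) (at t)"
      using DERIV_inverse_function[of T "1 / G (U t)" U t 0 "t + 1"] derivT[OF Upos[OF that]]
        pos[of "U t"] U that Upos[OF that] by fastforce
    then show ?thesis by simp
  qed
  then show ?thesis using that contU U0 Upos by blast
qed

text \<open>Gronwall: the squared distance of two solutions grows at rate at most
  \<open>2 * L\<close>, so after damping by \<open>exp (- (2 * L * t))\<close> it cannot increase
  from its initial value 0.\<close>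

lemma autonomous_ode_unique:
  fixes G u v :: "real \<Rightarrow> real"
  assumes lip: "L-lipschitz_on UNIV G"
    and u: "continuous_on {0..} u" "\<And>t. t > 0 \<Longrightarrow> (u has_real_derivative G (u t)) (at t)"
    and v: "continuous_on {0..} v" "\<And>t. t > 0 \<Longrightarrow> (v has_real_derivative G (v t)) (at t)"
    and init: "u 0 = v 0"
    and t: "t \<ge> 0"
  shows "u t = v t"
proof -
  define W where "W t = (u t - v t)\<^sup>2 * exp (- (2 * L * t))" for t
  have "W t \<le> W 0"
  proof (rule DERIV_nonpos_imp_decreasing_open[OF t])
    fix s assume "0 < s" "s < t"
    \<comment> \<open>The derivative of \<open>W\<close>, arranged so that the Lipschitz estimate
      gives its sign.\<close>
    define D where "D = 2 * exp (- (2 * L * s)) *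
      ((u s - v s) * (G (u s) - G (v s)) - L * (u s - v s)\<^sup>2)"
    have "(W has_real_derivative D) (at s)"
      unfolding W_def D_def
      by (rule derivative_eq_intros u v \<open>0 < s\<close> refl)+ (simp add: algebra_simps power2_eq_square)
    moreover have "(u s - v s) * (G (u s) - G (v s)) \<le> L * (u s - v s)\<^sup>2"
    proof -
      have "(u s - v s) * (G (u s) - G (v s)) \<le> \<bar>u s - v s\<bar> * \<bar>G (u s) - G (v s)\<bar>"
        by (metis abs_ge_self abs_mult)
      also have "\<dots> \<le> \<bar>u s - v s\<bar> * (L * \<bar>u s - v s\<bar>)"
        using lipschitz_onD[OF lip, of "u s" "v s"]
        by (intro mult_left_mono) (auto simp: dist_real_def)
      also have "\<dots> = L * (u s - v s)\<^sup>2" by (simp add: power2_eq_square)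
      finally show ?thesis .
    qed
    then have "D \<le> 0" unfolding D_def by (simp add: mult_nonneg_nonpos)
    ultimately show "\<exists>y. DERIV W s :> y \<and> y \<le> 0" by blast
  next
    show "continuous_on {0..t} W"
      unfolding W_def
      by (intro continuous_intros continuous_on_subset[OF u(1)] continuous_on_subset[OF v(1)]) auto
  qed
  also have "W 0 = 0" using init by (simp add: W_def)
  finally have "(u t - v t)\<^sup>2 \<le> 0" by (simp add: W_def mult_le_0_iff)
  then show ?thesis by simp
qed

section \<open>The right-hand side as a function of \<open>i - b\<close>\<close>

text \<open>This is \<open>rhs\<close> in the variable \<open>u = i - b\<close>, after cancelling
  \<open>exp (\<alpha> * u)\<close> and splitting off the limit \<open>- q / \<beta>\<close> at
  infinity, so that \<open>u\<close> occurs only once.\<close>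

definition drift :: "real \<Rightarrow> real \<Rightarrow> real \<Rightarrow> real \<Rightarrow> real" where
  "drift q \<alpha> \<beta> u = q * (\<alpha> - \<beta>) / (\<alpha> * (\<beta> - \<alpha> * exp ((\<beta> - \<alpha>) * u))) - q / \<beta>"

context
  fixes q \<alpha> \<beta> :: real
  assumes q: "q > 0" and \<alpha>: "\<alpha> < 0" and \<beta>: "\<beta> > 0"
begin

lemma denom_pos: "\<beta> - \<alpha> * exp x > 0"
  using \<alpha> \<beta> by (smt (verit) exp_gt_zero mult_neg_pos)

lemma rhs_eq_drift: "rhs q \<alpha> \<beta> b i = drift q \<alpha> \<beta> (i - b)"
proof -
  define t where "t = exp ((\<beta> - \<alpha>) * (i - b))"
  define e where "e = exp (\<alpha> * (i - b))"
  have e: "e > 0" by (simp add: e_def)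
  have t: "exp (\<beta> * (i - b)) = t * e"
    unfolding t_def e_def by (simp flip: exp_add add: algebra_simps)
  have d: "\<beta> - \<alpha> * t > 0" using denom_pos by (simp add: t_def)
  have "rhs q \<alpha> \<beta> b i = q / (\<alpha> * \<beta>) * ((e * (\<alpha>\<^sup>2 * t - \<beta>\<^sup>2)) / (e * (\<beta> - \<alpha> * t)))"
    unfolding rhs_def t e_def[symmetric] by (simp add: algebra_simps)
  also have "\<dots> = q / (\<alpha> * \<beta>) * ((\<alpha>\<^sup>2 * t - \<beta>\<^sup>2) / (\<beta> - \<alpha> * t))" using e by simp
  \<comment> \<open>Division in \<open>t\<close>: the numerator is \<open>- \<alpha>\<close> times
    the denominator plus the remainder \<open>\<beta> * (\<alpha> - \<beta>)\<close>.\<close>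
  also have "\<dots> = q * (\<alpha> - \<beta>) / (\<alpha> * (\<beta> - \<alpha> * t)) - q / \<beta>"
    using \<alpha> \<beta> d by (simp add: divide_simps) (simp add: algebra_simps power2_eq_square)
  finally show ?thesis by (simp add: drift_def t_def)
qed

lemma drift_has_derivative:
  "(drift q \<alpha> \<beta> has_real_derivative
     - q * (\<beta> - \<alpha>)\<^sup>2 * exp ((\<beta> - \<alpha>) * u) / (\<beta> - \<alpha> * exp ((\<beta> - \<alpha>) * u))\<^sup>2) (at u)"
proof -
  have d: "\<beta> - \<alpha> * exp ((\<beta> - \<alpha>) * u) \<noteq> 0" using denom_pos[of "(\<beta> - \<alpha>) * u"] by linarith
  let ?s = "\<beta> - \<alpha>" and ?t = "exp ((\<beta> - \<alpha>) * u)"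
  have "((\<lambda>u. \<alpha> * (\<beta> - \<alpha> * exp ((\<beta> - \<alpha>) * u))) has_real_derivative - \<alpha>\<^sup>2 * ?s * ?t) (at u)"
    by (rule derivative_eq_intros refl)+ (simp add: power2_eq_square)
  then have "(drift q \<alpha> \<beta> has_real_derivative
      (0 * (\<alpha> * (\<beta> - \<alpha> * ?t)) - q * (\<alpha> - \<beta>) * (- \<alpha>\<^sup>2 * ?s * ?t)) /
        ((\<alpha> * (\<beta> - \<alpha> * ?t)) * (\<alpha> * (\<beta> - \<alpha> * ?t))) - 0) (at u)"
    unfolding drift_def[abs_def]
    by (intro DERIV_diff DERIV_divide DERIV_const) (use d \<alpha> in auto)
  also have "(0 * (\<alpha> * (\<beta> - \<alpha> * ?t)) - q * (\<alpha> - \<beta>) * (- \<alpha>\<^sup>2 * ?s * ?t)) /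
        ((\<alpha> * (\<beta> - \<alpha> * ?t)) * (\<alpha> * (\<beta> - \<alpha> * ?t))) - 0 =
      (\<alpha>\<^sup>2 * (- q * ?s\<^sup>2 * ?t)) / (\<alpha>\<^sup>2 * (\<beta> - \<alpha> * ?t)\<^sup>2)"
    by (rule arg_cong2[where f = "\<lambda>x y. x / y - 0", THEN trans])
      (simp_all add: power2_eq_square algebra_simps)
  also have "\<dots> = - q * ?s\<^sup>2 * ?t / (\<beta> - \<alpha> * ?t)\<^sup>2"
    using \<alpha> by (intro mult_divide_mult_cancel_left) simp
  finally show ?thesis .
qed

lemma drift_strict_antimono:
  assumes "u < v"
  shows "drift q \<alpha> \<beta> v < drift q \<alpha> \<beta> u"
proof (rule DERIV_neg_imp_decreasing[OF assms])
  fix x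
  have "- q * (\<beta> - \<alpha>)\<^sup>2 * exp ((\<beta> - \<alpha>) * x) / (\<beta> - \<alpha> * exp ((\<beta> - \<alpha>) * x))\<^sup>2 < 0"
    using denom_pos[of "(\<beta> - \<alpha>) * x"] q \<alpha> \<beta> by (auto intro!: divide_neg_pos mult_neg_pos)
  then show "\<exists>y. DERIV (drift q \<alpha> \<beta>) x :> y \<and> y < 0"
    using drift_has_derivative by blast
qed

text \<open>The summand containing \<open>u\<close> is a quotient of two negative numbers. The bound
  limits the speed \<open>1 - drift\<close> and so excludes blow-up.\<close>

lemma drift_lower_bound: "- q / \<beta> < drift q \<alpha> \<beta> u"
proof -
  have "0 < q * (\<alpha> - \<beta>) / (\<alpha> * (\<beta> - \<alpha> * exp ((\<beta> - \<alpha>) * u)))"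
    using q \<alpha> \<beta> denom_pos[of "(\<beta> - \<alpha>) * u"] by (intro divide_neg_neg mult_pos_neg mult_neg_pos) auto
  then show ?thesis by (simp add: drift_def)
qed

text \<open>At this point \<open>exp ((\<beta> - \<alpha>) * u)\<close> equals
  \<open>\<beta>\<^sup>2 / \<alpha>\<^sup>2\<close>, which makes the numerator of \<open>rhs\<close>
  vanish. It is the starting value of \<open>i - b i\<close>.\<close>

lemma drift_b_circ: "drift q \<alpha> \<beta> (- b_circ \<alpha> \<beta>) = 0"
proof -
  have "(\<beta> - \<alpha>) * (- b_circ \<alpha> \<beta>) = ln (\<beta>\<^sup>2 / \<alpha>\<^sup>2)"
    using \<alpha> \<beta> by (simp add: b_circ_def divide_simps) (simp add: algebra_simps)
  then have "exp ((\<beta> - \<alpha>) * (- b_circ \<alpha> \<beta>)) = \<beta>\<^sup>2 / \<alpha>\<^sup>2"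
    using \<alpha> \<beta> by simp
  then have "drift q \<alpha> \<beta> (- b_circ \<alpha> \<beta>) = q * (\<alpha> - \<beta>) / (\<alpha> * (\<beta> - \<alpha> * (\<beta>\<^sup>2 / \<alpha>\<^sup>2))) - q / \<beta>"
    by (simp only: drift_def)
  also have "\<alpha> * (\<beta> - \<alpha> * (\<beta>\<^sup>2 / \<alpha>\<^sup>2)) = \<beta> * (\<alpha> - \<beta>)"
    using \<alpha> by (simp add: field_simps power2_eq_square)
  finally show ?thesis using \<alpha> \<beta> by simp
qed

lemma drift_lipschitz: "(- q * (\<beta> - \<alpha>)\<^sup>2 / (\<alpha> * \<beta>))-lipschitz_on UNIV (drift q \<alpha> \<beta>)"
proof (rule bounded_derivative_imp_lipschitz)
  show C: "0 \<le> - q * (\<beta> - \<alpha>)\<^sup>2 / (\<alpha> * \<beta>)"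
    using q \<alpha> \<beta> by (intro divide_nonpos_neg mult_neg_pos) (auto simp: mult_nonpos_nonneg)
  fix u
  let ?t = "exp ((\<beta> - \<alpha>) * u)"
  let ?D = "- q * (\<beta> - \<alpha>)\<^sup>2 * ?t / (\<beta> - \<alpha> * ?t)\<^sup>2"
  show "(drift q \<alpha> \<beta> has_derivative (*) ?D) (at u within UNIV)"
    using drift_has_derivative by (simp add: has_field_derivative_def)
  \<comment> \<open>Expanding the square gives three nonnegative terms because
    \<open>\<alpha> * \<beta> < 0\<close>; keeping half of the middle one makes the bound on
    \<open>?D\<close> uniform in \<open>u\<close>.\<close>
  have "- (\<alpha> * \<beta>) * ?t \<le> (\<beta> - \<alpha> * ?t)\<^sup>2"
  proof -
    have "0 \<le> \<beta>\<^sup>2 + (\<alpha> * ?t)\<^sup>2 - \<alpha> * \<beta> * ?t"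
      using \<alpha> \<beta> by (smt (verit) exp_gt_zero mult_neg_pos zero_le_power2)
    then show ?thesis by (simp add: power2_eq_square algebra_simps)
  qed
  then have "?t / (\<beta> - \<alpha> * ?t)\<^sup>2 \<le> 1 / (- (\<alpha> * \<beta>))"
    using denom_pos[of "(\<beta> - \<alpha>) * u"] mult_neg_pos[OF \<alpha> \<beta>] by (simp add: divide_simps mult.commute)
  then have "q * (\<beta> - \<alpha>)\<^sup>2 * (?t / (\<beta> - \<alpha> * ?t)\<^sup>2) \<le> q * (\<beta> - \<alpha>)\<^sup>2 * (1 / (- (\<alpha> * \<beta>)))"
    using q by (intro mult_left_mono) auto
  moreover have "\<bar>?D\<bar> = q * (\<beta> - \<alpha>)\<^sup>2 * (?t / (\<beta> - \<alpha> * ?t)\<^sup>2)"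
    using q by (simp add: abs_mult)
  moreover have "q * (\<beta> - \<alpha>)\<^sup>2 * (1 / (- (\<alpha> * \<beta>))) = - q * (\<beta> - \<alpha>)\<^sup>2 / (\<alpha> * \<beta>)" by simp
  ultimately have "\<bar>?D\<bar> \<le> - q * (\<beta> - \<alpha>)\<^sup>2 / (\<alpha> * \<beta>)" by (simp only:)
  then show "onorm ((*) ?D) \<le> - q * (\<beta> - \<alpha>)\<^sup>2 / (\<alpha> * \<beta>)"
    by (intro onorm_bound C) (simp only: real_norm_def abs_mult[of ?D] mult_right_mono abs_ge_zero)
qed simp

section \<open>Existence and uniqueness for the Cauchy problem\<close>

text \<open>Passing from \<open>b\<close> to \<open>i - b i\<close> is an involution, so the same
  difference rules carry continuity and derivatives in both directions.\<close>

lemma cauchy_solution_iff: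
  "cauchy_solution q \<alpha> \<beta> b \<longleftrightarrow>
     continuous_on {0..} (\<lambda>i. i - b i) \<and>
     (\<forall>i>0. ((\<lambda>i. i - b i) has_real_derivative 1 - drift q \<alpha> \<beta> (i - b i)) (at i)) \<and>
     0 - b 0 = - b_circ \<alpha> \<beta>"
proof -
  have "continuous_on {0..} b \<longleftrightarrow> continuous_on {0..} (\<lambda>i. i - b i)"
    using continuous_on_diff[OF continuous_on_id, of "{0..}" b]
      continuous_on_diff[OF continuous_on_id, of "{0..}" "\<lambda>i. i - b i"] by auto
  moreover have "(b has_real_derivative d) (at i) \<longleftrightarrow>
      ((\<lambda>i. i - b i) has_real_derivative 1 - d) (at i)" for d i
    using DERIV_diff[OF DERIV_ident, of b d i UNIV]
      DERIV_diff[OF DERIV_ident, of "\<lambda>i. i - b i" "1 - d" i UNIV] by auto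
  ultimately show ?thesis
    unfolding cauchy_solution_def rhs_eq_drift by auto
qed

text \<open>The second conclusion keeps \<open>i - b i\<close> beyond the zero of
  \<open>drift\<close>; it later fixes the sign of the derivative of \<open>b\<close>.\<close>

lemma cauchy_solution_exists:
  obtains b where "cauchy_solution q \<alpha> \<beta> b" and "\<And>i. i > 0 \<Longrightarrow> - b_circ \<alpha> \<beta> < i - b i"
proof -
  define G where "G u = 1 - drift q \<alpha> \<beta> u" for u
  have "continuous_on {- b_circ \<alpha> \<beta>..} G"
    unfolding G_def
    using lipschitz_on_continuous_on[OF drift_lipschitz]
    by (intro continuous_intros) (auto intro: continuous_on_subset)
  \<comment> \<open>From its zero onwards the decreasing \<open>drift\<close> is at most 0, so
    \<open>G\<close> is at least 1.\<close>
  moreover have "0 < G u" if "u \<ge> - b_circ \<alpha> \<beta>" for u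
    using drift_strict_antimono[of "- b_circ \<alpha> \<beta>" u] drift_b_circ that
    by (cases "u = - b_circ \<alpha> \<beta>") (auto simp: G_def)
  moreover have "G u \<le> 1 + q / \<beta>" for u
    using drift_lower_bound[of u] by (simp add: G_def)
  ultimately obtain U where "continuous_on {0..} U" "U 0 = - b_circ \<alpha> \<beta>"
    "\<And>t. t > 0 \<Longrightarrow> - b_circ \<alpha> \<beta> < U t"
    "\<And>t. t > 0 \<Longrightarrow> (U has_real_derivative G (U t)) (at t)"
    using autonomous_ode_exists by metis
  then show ?thesis
    by (intro that[of "\<lambda>i. i - U i"]) (simp_all add: cauchy_solution_iff G_def)
qed

lemma cauchy_solution_unique:
  assumes "cauchy_solution q \<alpha> \<beta> b" "cauchy_solution q \<alpha> \<beta> c" "i \<ge> 0"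
  shows "c i = b i"
proof -
  obtain L where "L-lipschitz_on UNIV (\<lambda>u. 1 - drift q \<alpha> \<beta> u)"
    using lipschitz_on_diff[OF lipschitz_on_constant drift_lipschitz] by blast
  then have "i - c i = i - b i"
    by (rule autonomous_ode_unique[where u = "\<lambda>i. i - c i" and v = "\<lambda>i. i - b i"])
      (use assms in \<open>simp_all add: cauchy_solution_iff\<close>)
  then show ?thesis by simp
qed

end

section \<open>Monotonicity and limits of the solution\<close>

theorem theorem5p2:
  fixes \<mu> \<eta> \<rho> q \<alpha> \<beta> :: real
  assumes "\<mu> > 0" and "\<eta> > 0" and "\<rho> > 0" and "q > 0"
    and "\<alpha> < 0" and "0 < \<beta>"
    and "1 / 2 * \<eta>\<^sup>2 * \<alpha>\<^sup>2 + \<mu> * \<alpha> - \<rho> = 0"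
    and "1 / 2 * \<eta>\<^sup>2 * \<beta>\<^sup>2 + \<mu> * \<beta> - \<rho> = 0"
  shows "\<exists>b. cauchy_solution q \<alpha> \<beta> b \<and>
             (\<forall>c. cauchy_solution q \<alpha> \<beta> c \<longrightarrow> (\<forall>i\<ge>0. c i = b i)) \<and>
             strict_antimono_on {0<..} b \<and>
             (deriv b \<longlongrightarrow> 0) (at_right 0) \<and>
             filterlim b at_bot at_top"
proof -
  note q\<alpha>\<beta> = \<open>q > 0\<close> \<open>\<alpha> < 0\<close> \<open>\<beta> > 0\<close>
  let ?F = "drift q \<alpha> \<beta>" and ?u0 = "- b_circ \<alpha> \<beta>"
  obtain b where sol: "cauchy_solution q \<alpha> \<beta> b" and above: "\<And>i. i > 0 \<Longrightarrow> ?u0 < i - b i"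
    using cauchy_solution_exists[OF q\<alpha>\<beta>] by blast
  have contb: "continuous_on {0..} b" and b0: "b 0 = b_circ \<alpha> \<beta>"
    and derivb: "\<And>i. i > 0 \<Longrightarrow> (b has_real_derivative ?F (i - b i)) (at i)"
    using sol by (auto simp: cauchy_solution_def rhs_eq_drift[OF q\<alpha>\<beta>])
  have neg: "?F (i - b i) < 0" if "i > 0" for i
    using drift_strict_antimono[OF q\<alpha>\<beta> above[OF that]] drift_b_circ[OF q\<alpha>\<beta>] by simp
  \<comment> \<open>Continuity at 0 lets \<open>x = 0\<close> be included, which gives the
    comparison of \<open>b i\<close> with \<open>b 0\<close> used for the limit at infinity.\<close>
  have decr: "b y < b x" if "0 \<le> x" "x < y" for x y
  proof (rule DERIV_neg_imp_decreasing_open[OF \<open>x < y\<close>])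
    show "continuous_on {x..y} b"
      by (rule continuous_on_subset[OF contb]) (use that in auto)
    show "\<exists>d. DERIV b z :> d \<and> d < 0" if "x < z" for z
      using derivb[of z] neg[of z] that \<open>0 \<le> x\<close> by auto
  qed
  have "strict_antimono_on {0<..} b"
    by (intro monotone_onI) (use decr in auto)
  moreover have "(deriv b \<longlongrightarrow> 0) (at_right 0)"
  proof -
    have "(b \<longlongrightarrow> b 0) (at_right 0)"
      using contb by (auto simp: continuous_on_def intro: tendsto_within_subset)
    then have "((\<lambda>i. i - b i) \<longlongrightarrow> 0 - b 0) (at_right 0)"
      by (intro tendsto_intros)
    moreover have "isCont ?F ?u0"
      using drift_has_derivative[OF q\<alpha>\<beta>] by (rule DERIV_isCont)
    ultimately have "((\<lambda>i. ?F (i - b i)) \<longlongrightarrow> ?F ?u0) (at_right 0)"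
      by (intro isCont_tendsto_compose[of _ ?F]) (simp_all add: b0)
    \<comment> \<open>The differential equation identifies \<open>deriv b\<close> only for
      \<open>i > 0\<close>, which is all that \<open>at_right 0\<close> sees.\<close>
    moreover have "\<forall>\<^sub>F i in at_right 0. ?F (i - b i) = deriv b i"
      using eventually_at_right_less[of 0]
      by eventually_elim (simp add: DERIV_imp_deriv[OF derivb])
    ultimately show ?thesis
      using drift_b_circ[OF q\<alpha>\<beta>] tendsto_cong by force
  qed
  moreover have "filterlim b at_bot at_top"
  proof -
    \<comment> \<open>Since \<open>b\<close> decreases from \<open>b_circ\<close>, the variable
      \<open>i - b i\<close> exceeds \<open>?u0 + 1\<close> once \<open>i > 1\<close>. There
      \<open>?F\<close> is at most \<open>k < 0\<close>, so the slope of \<open>b\<close> is bounded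
      away from 0 and \<open>b\<close> stays below a line of slope \<open>k\<close>.\<close>
    define k where "k = ?F (?u0 + 1)"
    have k: "k < 0"
      using drift_strict_antimono[OF q\<alpha>\<beta>, of ?u0 "?u0 + 1"] drift_b_circ[OF q\<alpha>\<beta>]
      by (simp add: k_def)
    have slope: "?F (i - b i) \<le> k" if "i > 1" for i
    proof -
      have "?u0 + 1 < i - b i" using decr[of 0 i] b0 that by simp
      then show ?thesis using drift_strict_antimono[OF q\<alpha>\<beta>] unfolding k_def by force
    qed
    have line: "b i \<le> b 1 + k * (i - 1)" if "i \<ge> 1" for i
    proof -
      have "b i - k * i \<le> b 1 - k * 1"
      proof (rule DERIV_nonpos_imp_decreasing_open[OF that])
        fix x assume "1 < x" "x < i"
        then have "((\<lambda>i. b i - k * i) has_real_derivative ?F (x - b x) - k) (at x)"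
          by (auto intro!: derivative_eq_intros derivb)
        then show "\<exists>y. ((\<lambda>i. b i - k * i) has_real_derivative y) (at x) \<and> y \<le> 0"
          using slope[OF \<open>1 < x\<close>] by force
      qed (intro continuous_intros continuous_on_subset[OF contb], auto)
      then show ?thesis by (simp add: algebra_simps)
    qed
    show ?thesis
      unfolding filterlim_at_bot
    proof
      fix Z
      show "\<forall>\<^sub>F i in at_top. b i \<le> Z"
        \<comment> \<open>The second threshold solves \<open>b 1 + k * (i - 1) = Z\<close> for
          \<open>i\<close>; beyond it the line lies below \<open>Z\<close> because
          \<open>k < 0\<close>. The threshold 1 makes \<open>line\<close> applicable.\<close>
        using eventually_ge_at_top[of "max 1 (1 + (Z - b 1) / k)"]
      proof eventually_elim
        case (elim i)
        then have "k * (i - 1) \<le> k * ((Z - b 1) / k)"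
          using k by (intro mult_left_mono_neg) auto
        then show ?case using line[of i] elim k by simp
      qed
    qed
  qed
  ultimately show ?thesis
    using sol cauchy_solution_unique[OF q\<alpha>\<beta> sol] by blast
qed

end
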